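(* Let $\mathcal{F}$ be a saturated fusion system over a finite $p$-group $S$. For subgroups $Q,P\le S$, let $\mathfrak{BC}_{\mathcal{F}}(Q,P)$ denote the set of $\mathcal{F}$-broken chains linking $Q$ to $P$. Then the number $c_Q(\alpha_P)$ of $[S/Q]$-orbits in the irreducible $\mathcal{F}$-stable set $\alpha_P$ is $$c_Q(\alpha_P)=\frac{|W_SP^*|}{|W_SQ|}\cdot\sum_{\sigma\in\mathfrak{BC}_{\mathcal{F}}(Q,P)}(-1)^{\ell(\sigma)}$$ for all subgroups $Q,P$ of $S$, where $P^*\sim_{\mathcal{F}}P$ is fully normalized.
   Context: A fusion system $\mathcal{F}$ on a finite $p$-group $S$, and its being saturated, are meant in the standard sense (Aschbacher–Kessar–Oliver). Subgroups $P,Q\le S$ are $\mathcal{F}$-conjugate, written $P\sim_{\mathcal{F}}Q$, if they are isomorphic in $\mathcal{F}$. A subgroup $P$ is fully normalized (in $\mathcal{F}$) if $|N_S(P)|\ge |N_S(P')|$ for all $P'\sim_{\mathcal{F}}P$. Write $W_SP:=N_S(P)/P$. For a finite $S$-set $X$ and $Q\le S$, $c_Q(X)$ is the number of orbits of $X$ isomorphic to $S/Q$. A finite $S$-set $X$ is $\mathcal{F}$-stable if for all $P\le S$ and all $\varphi\in\mathcal{F}(P,S)$ the $P$-set obtained by restricting the action along $\varphi$ is isomorphic to the $P$-set obtained by restricting along the inclusion; equivalently, $|X^P|=|X^{Q}|$ whenever $P\sim_{\mathcal{F}}Q$. It is known (Reeh) that for each $\mathcal{F}$-conjugacy class $[P]_{\mathcal{F}}$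 there is a unique (up to $S$-isomorphism) $\mathcal{F}$-stable $S$-set $\alpha_P$ such that (1) $c_Q(\alpha_P)=1$ if $Q$ is fully normalized and $Q\sim_{\mathcal{F}}P$; (2) $c_Q(\alpha_P)=0$ if $Q$ is fully normalized and $Q\not\sim_{\mathcal{F}}P$. The $\alpha_P$ are the irreducible $\mathcal{F}$-stable sets, i.e. those not expressible as disjoint unions of smaller $\mathcal{F}$-stable sets. Let $\mathcal{P}$ be the poset of all subgroups of $S$ under inclusion, and fix a set $\mathcal{P}^*\subseteq\mathcal{P}$ of fully normalized representatives, one for each $\mathcal{F}$-conjugacy class. A chain in $\mathcal{P}$ is a sequence $\tau=(a_0<a_1<\dots<a_n)$ with $n\ge 0$; its length is $|\tau|:=n$; it is trivial if $n=0$. An $\mathcal{F}$-broken chain linking $Q\in\mathcal{P}$ to $P\in\mathcal{P}$ is a sequence of chains $\sigma=(\sigma_0,\sigma_1,\dots,\sigma_k)$ in $\mathcal{P}$, $k\ge 0$, with $\sigma_i=(a^i_0<\dots<a^i_{n_i})$, such that (i) $a^i_{n_i}\sim_{\mathcal{F}}a^{i+1}_0$ for $0\le i\le k-1$; (ii) $a^i_0\in\mathcal{P}^*$ for $1\le i\le k$; (iii) $|\sigma_i|=n_i>0$ for $1\le i\le k$ (while $\sigma_0$ is allowed to be trivial); (iv) $a^0_0=Q$ and $a^k_{n_k}\sim_{\mathcal{F}}P$. In particular, if $Q\sim_{\mathcal{F}}P$, the trivial broken chain with $k=0$ and $\sigma_0$ trivial is allowed. The total length is $\ell(\sigma):=k+|\sigma_0|+\dots+|\sigma_k|$.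 *)

theory Defs
  imports
    Complex_Main
    "HOL-Algebra.Group_Action"
    "HOL-Algebra.Left_Coset"
    "HOL-Computational_Algebra.Primes"
begin

text \<open>
  A category whose objects are the subgroups of \<open>S\<close> and whose morphisms are group homomorphisms is
  given by a function \<open>F\<close>: the morphisms from \<open>P\<close> to \<open>Q\<close> are the elements of \<open>F P Q\<close>.  Only the
  values of \<open>F\<close> at subgroups of \<open>S\<close> matter.  A map with domain \<open>P\<close> is represented by a function
  which is extensional on \<open>P\<close>, so that equality of morphisms is equality of functions.
\<close>

subsection \<open>Fusion systems\<close>

definition conj_map :: "('a, 'c) monoid_scheme \<Rightarrow> 'a set \<Rightarrow> 'a \<Rightarrow> 'a \<Rightarrow> 'a" where
  "conj_map S P g = (\<lambda>x\<in>P. g \<otimes>\<^bsub>S\<^esub> x \<otimes>\<^bsub>S\<^esub> inv\<^bsub>S\<^esub> g)"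

definition Hom_grp :: "('a, 'c) monoid_scheme \<Rightarrow> 'a set \<Rightarrow> 'a set \<Rightarrow> ('a \<Rightarrow> 'a) set" where
  "Hom_grp S P Q = {conj_map S P g | g. g \<in> carrier S \<and> conj_map S P g ` P \<subseteq> Q}"

definition Inj_grp :: "('a, 'c) monoid_scheme \<Rightarrow> 'a set \<Rightarrow> 'a set \<Rightarrow> ('a \<Rightarrow> 'a) set" where
  "Inj_grp S P Q = mon (S\<lparr>carrier := P\<rparr>) (S\<lparr>carrier := Q\<rparr>) \<inter> extensional P"

definition Iso_fus :: "('a set \<Rightarrow> 'a set \<Rightarrow> ('a \<Rightarrow> 'a) set) \<Rightarrow> 'a set \<Rightarrow> 'a set \<Rightarrow> ('a \<Rightarrow> 'a) set" where
  "Iso_fus F P Q =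
     {\<phi> \<in> F P Q. \<exists>\<psi>\<in>F Q P. compose P \<psi> \<phi> = (\<lambda>x\<in>P. x) \<and> compose Q \<phi> \<psi> = (\<lambda>x\<in>Q. x)}"

locale fusion_system = group S for S :: "('a, 'c) monoid_scheme" (structure) +
  fixes p :: nat and F :: "'a set \<Rightarrow> 'a set \<Rightarrow> ('a \<Rightarrow> 'a) set"
  assumes prime_p: "prime p"
    and p_group: "\<exists>n. order S = p ^ n"
    and comp_closed: "\<lbrakk>subgroup P S; subgroup Q S; subgroup R S; \<phi> \<in> F P Q; \<psi> \<in> F Q R\<rbrakk>
           \<Longrightarrow> compose P \<psi> \<phi> \<in> F P R"
    and Hom_grp_subset: "\<lbrakk>subgroup P S; subgroup Q S\<rbrakk> \<Longrightarrow> Hom_grp S P Q \<subseteq> F P Q"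
    and subset_Inj_grp: "\<lbrakk>subgroup P S; subgroup Q S\<rbrakk> \<Longrightarrow> F P Q \<subseteq> Inj_grp S P Q"
    and iso_inclusion: "\<lbrakk>subgroup P S; subgroup Q S; \<phi> \<in> F P Q\<rbrakk>
           \<Longrightarrow> \<exists>R. subgroup R S \<and> R \<subseteq> Q \<and> (\<exists>\<psi>\<in>Iso_fus F P R. \<phi> = compose P (\<lambda>x\<in>R. x) \<psi>)"

definition fus_conj :: "('a set \<Rightarrow> 'a set \<Rightarrow> ('a \<Rightarrow> 'a) set) \<Rightarrow> 'a set \<Rightarrow> 'a set \<Rightarrow> bool" where
  "fus_conj F P Q \<longleftrightarrow> Iso_fus F P Q \<noteq> {}"

definition fully_normalized ::
  "('a, 'c) monoid_scheme \<Rightarrow> ('a set \<Rightarrow> 'a set \<Rightarrow> ('a \<Rightarrow> 'a) set) \<Rightarrow> 'a set \<Rightarrow> bool" where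
  "fully_normalized S F P \<longleftrightarrow> subgroup P S \<and>
     (\<forall>P'. subgroup P' S \<and> fus_conj F P' P \<longrightarrow> card (normalizer S P) \<ge> card (normalizer S P'))"

definition sylow_subgroup :: "nat \<Rightarrow> ('g, 'd) monoid_scheme \<Rightarrow> 'g set \<Rightarrow> bool" where
  "sylow_subgroup p G H \<longleftrightarrow> subgroup H G \<and> card H = p ^ multiplicity p (order G)"

definition Aut_fus :: "('a set \<Rightarrow> 'a set \<Rightarrow> ('a \<Rightarrow> 'a) set) \<Rightarrow> 'a set \<Rightarrow> ('a \<Rightarrow> 'a) monoid" where
  "Aut_fus F P = (BijGroup P)\<lparr>carrier := F P P\<rparr>"

definition fully_automized ::
  "('a, 'c) monoid_scheme \<Rightarrow> nat \<Rightarrow> ('a set \<Rightarrow> 'a set \<Rightarrow> ('a \<Rightarrow> 'a) set) \<Rightarrow> 'a set \<Rightarrow> bool" where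
  "fully_automized S p F P \<longleftrightarrow> sylow_subgroup p (Aut_fus F P) (Hom_grp S P P)"

text \<open>The group \<open>N\<^sub>\<phi>\<close> for an isomorphism \<open>\<phi>\<close> from \<open>Q\<close> to \<open>P\<close>; the composite is \<open>\<phi> c\<^sub>g \<phi>\<^sup>-\<^sup>1\<close>.\<close>

definition extender ::
  "('a, 'c) monoid_scheme \<Rightarrow> 'a set \<Rightarrow> 'a set \<Rightarrow> ('a \<Rightarrow> 'a) \<Rightarrow> 'a set" where
  "extender S Q P \<phi> =
     {g \<in> normalizer S Q.
        compose P \<phi> (compose P (conj_map S Q g) (\<lambda>y\<in>P. inv_into Q \<phi> y)) \<in> Hom_grp S P P}"

definition receptive ::
  "('a, 'c) monoid_scheme \<Rightarrow> ('a set \<Rightarrow> 'a set \<Rightarrow> ('a \<Rightarrow> 'a) set) \<Rightarrow> 'a set \<Rightarrow> bool" where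
  "receptive S F P \<longleftrightarrow>
     (\<forall>Q \<phi>. subgroup Q S \<and> \<phi> \<in> Iso_fus F Q P \<longrightarrow>
        (\<exists>\<psi>\<in>F (extender S Q P \<phi>) (carrier S). restrict \<psi> Q = \<phi>))"

locale saturated_fusion_system = fusion_system +
  assumes saturated: "subgroup P S \<Longrightarrow>
    \<exists>Q. subgroup Q S \<and> fus_conj F P Q \<and> fully_automized S p F Q \<and> receptive S F Q"

definition W :: "('a, 'c) monoid_scheme \<Rightarrow> 'a set \<Rightarrow> 'a set monoid" where
  "W S P = S\<lparr>carrier := normalizer S P\<rparr> Mod P"

subsection \<open>Stable sets\<close>

text \<open>
  In this definition \<open>a\<close> and \<open>b\<close> need not be extensional: an action restricted along a
  homomorphism \<open>\<phi>\<close> is written as \<open>\<lambda>g. a (\<phi> g)\<close>.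
\<close>

definition gset_iso ::
  "'g set \<Rightarrow> 'x set \<Rightarrow> ('g \<Rightarrow> 'x \<Rightarrow> 'x) \<Rightarrow> 'y set \<Rightarrow> ('g \<Rightarrow> 'y \<Rightarrow> 'y) \<Rightarrow> bool" where
  "gset_iso G X a Y b \<longleftrightarrow> (\<exists>f. bij_betw f X Y \<and> (\<forall>g\<in>G. \<forall>x\<in>X. f (a g x) = b g (f x)))"

definition orbit_count ::
  "('a, 'c) monoid_scheme \<Rightarrow> 'x set \<Rightarrow> ('a \<Rightarrow> 'x \<Rightarrow> 'x) \<Rightarrow> 'a set \<Rightarrow> nat" where
  "orbit_count S X a Q =
     card {Y \<in> orbits S X a. gset_iso (carrier S) Y a (lcosets\<^bsub>S\<^esub> Q) (\<lambda>g C. g <#\<^bsub>S\<^esub> C)}"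

definition fus_stable ::
  "('a, 'c) monoid_scheme \<Rightarrow> ('a set \<Rightarrow> 'a set \<Rightarrow> ('a \<Rightarrow> 'a) set) \<Rightarrow>
     'x set \<Rightarrow> ('a \<Rightarrow> 'x \<Rightarrow> 'x) \<Rightarrow> bool" where
  "fus_stable S F X a \<longleftrightarrow>
     (\<forall>P \<phi>. subgroup P S \<and> \<phi> \<in> F P (carrier S) \<longrightarrow> gset_iso P X (\<lambda>g. a (\<phi> g)) X a)"

text \<open>
  \<open>is_alpha S F P X a\<close>: the set \<open>X\<close> with the action \<open>a\<close> is a model of the irreducible stable set
  \<open>\<alpha>\<^sub>P\<close>.  By a theorem of Reeh, over a saturated fusion system such a model exists and is unique up
  to isomorphism.
\<close>

definition is_alpha ::
  "('a, 'c) monoid_scheme \<Rightarrow> ('a set \<Rightarrow> 'a set \<Rightarrow> ('a \<Rightarrow> 'a) set) \<Rightarrow> 'a set \<Rightarrow>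
     'x set \<Rightarrow> ('a \<Rightarrow> 'x \<Rightarrow> 'x) \<Rightarrow> bool" where
  "is_alpha S F P X a \<longleftrightarrow>
     group_action S X a \<and> finite X \<and> fus_stable S F X a \<and>
     (\<forall>Q. fully_normalized S F Q \<and> fus_conj F Q P \<longrightarrow> orbit_count S X a Q = 1) \<and>
     (\<forall>Q. fully_normalized S F Q \<and> \<not> fus_conj F Q P \<longrightarrow> orbit_count S X a Q = 0)"

subsection \<open>Broken chains\<close>

definition fn_representatives ::
  "('a, 'c) monoid_scheme \<Rightarrow> ('a set \<Rightarrow> 'a set \<Rightarrow> ('a \<Rightarrow> 'a) set) \<Rightarrow> 'a set set \<Rightarrow> bool" where
  "fn_representatives S F Ps \<longleftrightarrow>
     (\<forall>R\<in>Ps. fully_normalized S F R) \<and> (\<forall>P. subgroup P S \<longrightarrow> (\<exists>!R. R \<in> Ps \<and> fus_conj F R P))"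

definition is_chain :: "('a, 'c) monoid_scheme \<Rightarrow> 'a set list \<Rightarrow> bool" where
  "is_chain S \<tau> \<longleftrightarrow> \<tau> \<noteq> [] \<and> (\<forall>P\<in>set \<tau>. subgroup P S) \<and> sorted_wrt (\<subset>) \<tau>"

definition chain_length :: "'a set list \<Rightarrow> nat" where
  "chain_length \<tau> = length \<tau> - 1"

definition broken_chains ::
  "('a, 'c) monoid_scheme \<Rightarrow> ('a set \<Rightarrow> 'a set \<Rightarrow> ('a \<Rightarrow> 'a) set) \<Rightarrow> 'a set set \<Rightarrow>
     'a set \<Rightarrow> 'a set \<Rightarrow> 'a set list list set" where
  "broken_chains S F Ps Q P =
     {\<sigma>. \<sigma> \<noteq> [] \<and> (\<forall>\<tau>\<in>set \<sigma>. is_chain S \<tau>) \<and>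
         (\<forall>i. Suc i < length \<sigma> \<longrightarrow> fus_conj F (last (\<sigma> ! i)) (hd (\<sigma> ! Suc i))) \<and>
         (\<forall>i. 1 \<le> i \<and> i < length \<sigma> \<longrightarrow> hd (\<sigma> ! i) \<in> Ps) \<and>
         (\<forall>i. 1 \<le> i \<and> i < length \<sigma> \<longrightarrow> chain_length (\<sigma> ! i) > 0) \<and>
         hd (hd \<sigma>) = Q \<and> fus_conj F (last (last \<sigma>)) P}"

text \<open>A broken chain \<open>(\<sigma>\<^sub>0, \<dots>, \<sigma>\<^sub>k)\<close> is a list with \<open>k + 1\<close> entries.\<close>

definition total_length :: "'a set list list \<Rightarrow> nat" where
  "total_length \<sigma> = (length \<sigma> - 1) + sum_list (map chain_length \<sigma>)"

end

theory Submission
  imports Defs "HOL-Algebra.Zassenhaus"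
begin

text \<open>
  Let \<open>u R\<close> be the number of points of \<open>\<alpha>\<^sub>P\<close> with stabilizer exactly \<open>R\<close>.  Each orbit isomorphic to
  \<open>S/R\<close> contains \<open>|W\<^sub>S R|\<close> such points and no other orbit contains any, so
  \<open>u R = c\<^sub>R(\<alpha>\<^sub>P) |W\<^sub>S R|\<close>, and the number of points fixed by \<open>Q\<close> is the sum of \<open>u R\<close> over \<open>R \<ge> Q\<close>.
  If \<open>R\<close> is the fully normalized representative of the class of \<open>Q\<close>, stability equates the numbers of
  fixed points of \<open>Q\<close> and \<open>R\<close>, and \<open>u R\<close> is \<open>|W\<^sub>S P\<^sup>*|\<close> or \<open>0\<close>.  This expresses \<open>u Q\<close> through the values
  of \<open>u\<close> at subgroups of larger order.  The signed number of broken chains satisfies the same recursion: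
  if \<open>\<sigma>\<^sub>0\<close> is nontrivial, remove its first subgroup; if it is trivial and \<open>k > 0\<close>, then \<open>\<sigma>\<^sub>1\<close> starts at \<open>R\<close>,
  and one removes both \<open>\<sigma>\<^sub>0\<close> and this first \<open>R\<close>.
\<close>

section \<open>Orbits and stabilizers\<close>

context group
begin

lemma mem_conjugate_iff:
  assumes "g \<in> carrier G" "h \<in> carrier G" "H \<subseteq> carrier G"
  shows "h \<in> g <# H #> inv g \<longleftrightarrow> inv g \<otimes> h \<otimes> g \<in> H"
proof
  assume "h \<in> g <# H #> inv g"
  then obtain k where k: "k \<in> H" "h = g \<otimes> k \<otimes> inv g"
    by (auto simp: l_coset_def r_coset_def)
  with assms have kc: "k \<in> carrier G" by auto
  have "inv g \<otimes> (g \<otimes> k \<otimes> inv g) \<otimes> g = (inv g \<otimes> g) \<otimes> k \<otimes> (inv g \<otimes> g)"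
    using assms kc by (simp only: m_assoc m_closed inv_closed)
  also have "\<dots> = k"
    using assms kc by simp
  finally show "inv g \<otimes> h \<otimes> g \<in> H"
    using k by simp
next
  assume H: "inv g \<otimes> h \<otimes> g \<in> H"
  have "g \<otimes> (inv g \<otimes> h \<otimes> g) \<otimes> inv g = h"
    using conjugation_is_surj assms by blast
  with H show "h \<in> g <# H #> inv g"
    by (force simp: l_coset_def r_coset_def)
qed

lemma normalizer_eq:
  assumes "H \<subseteq> carrier G"
  shows "normalizer G H = {g \<in> carrier G. g <# H #> inv g = H}"
  using assms by (simp add: normalizer_def stabilizer_def)

lemma subgroup_subset_normalizer:
  assumes "subgroup H G"
  shows "H \<subseteq> normalizer G H"
  using subgroup_in_normalizer[OF assms] normal_imp_subgroup subgroup.subset by force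

text \<open>Lagrange inside the normalizer: the carrier of \<open>W G H\<close> is the set of cosets
  of \<open>H\<close> in \<open>normalizer G H\<close>.\<close>

lemma order_W:
  assumes "subgroup H G"
  shows "order (W G H) * card H = card (normalizer G H)"
proof -
  interpret N: group "G\<lparr>carrier := normalizer G H\<rparr>"
    using assms by (simp add: normalizer_imp_subgroup subgroup.subset subgroup_imp_group)
  have "subgroup H (G\<lparr>carrier := normalizer G H\<rparr>)"
    using subgroup_in_normalizer[OF assms] normal_imp_subgroup by blast
  from N.lagrange[OF this] show ?thesis
    by (simp add: W_def FactGroup_def order_def)
qed

lemma l_coset_self_iff:
  assumes "subgroup H G" "g \<in> carrier G"
  shows "g <# H = H \<longleftrightarrow> g \<in> H"
  by (metis assms coset_join3 lcos_self)

end

section \<open>Stabilizers, orbits as coset spaces, and point counts\<close>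

context group_action
begin

lemma act_inv_act:
  assumes "g \<in> carrier G" "x \<in> E"
  shows "\<phi> (inv g) (\<phi> g x) = x"
  using orbit_sym_aux assms by blast

lemma mem_stabilizer_act_iff:
  assumes "x \<in> E" "g \<in> carrier G" "h \<in> carrier G"
  shows "h \<in> stabilizer G \<phi> (\<phi> g x) \<longleftrightarrow> inv g \<otimes> h \<otimes> g \<in> stabilizer G \<phi> x"
proof -
  interpret group G
    using group_hom group_hom.axioms(1) by blast
  have gx: "\<phi> g x \<in> E"
    using assms element_image by blast
  have hgx: "\<phi> h (\<phi> g x) \<in> E"
    using assms gx element_image by blast
  have "\<phi> (inv g \<otimes> h \<otimes> g) x = \<phi> (inv g) (\<phi> h (\<phi> g x))"
    using assms gx by (simp add: composition_rule)
  moreover have "\<phi> (inv g) (\<phi> h (\<phi> g x)) = x \<longleftrightarrow> \<phi> h (\<phi> g x) = \<phi> g x"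
    using act_inv_act[of g] assms gx hgx inj_prop[of "inv g"]
    by (metis inj_onD inv_closed)
  ultimately show ?thesis
    using assms by (simp add: stabilizer_def)
qed

lemma stabilizer_act:
  assumes "x \<in> E" "g \<in> carrier G"
  shows "stabilizer G \<phi> (\<phi> g x) = g <# stabilizer G \<phi> x #> inv g"
proof -
  interpret group G
    using group_hom group_hom.axioms(1) by blast
  have sub: "stabilizer G \<phi> x \<subseteq> carrier G"
    by (rule stabilizer_subset)
  have "g <# stabilizer G \<phi> x #> inv g \<subseteq> carrier G"
    by (simp add: assms l_coset_subset_G r_coset_subset_G sub)
  then show ?thesis
    using mem_stabilizer_act_iff[OF assms] mem_conjugate_iff[OF assms(2) _ sub] stabilizer_subset
    by blast
qed

lemma act_eq_iff:
  assumes "x \<in> E" "g \<in> carrier G" "h \<in> carrier G"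
  shows "\<phi> g x = \<phi> h x \<longleftrightarrow> inv h \<otimes> g \<in> stabilizer G \<phi> x"
proof -
  interpret group G
    using group_hom group_hom.axioms(1) by blast
  have "\<phi> g x \<in> E" "\<phi> h x \<in> E"
    using assms element_image by blast+
  then have "\<phi> (inv h) (\<phi> g x) = x \<longleftrightarrow> \<phi> g x = \<phi> h x"
    using act_inv_act[of h] assms inj_prop[of "inv h"] by (metis inj_onD inv_closed)
  then show ?thesis
    using assms by (simp add: stabilizer_def composition_rule)
qed

text \<open>The isomorphism sends \<open>g x\<close> to \<open>g R\<close>, where \<open>R\<close>
  is the stabilizer of \<open>x\<close>: two group elements carry \<open>x\<close> to the same point
  iff they lie in the same left coset of \<open>R\<close>.\<close>

lemma orbit_gset_iso_lcosets:
  assumes x: "x \<in> E"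
  shows "gset_iso (carrier G) (orbit G \<phi> x) \<phi> (lcosets (stabilizer G \<phi> x)) (\<lambda>g C. g <# C)"
proof -
  interpret group G
    using group_hom group_hom.axioms(1) by blast
  let ?R = "stabilizer G \<phi> x"
  have R: "subgroup ?R G"
    using x by (rule stabilizer_subgroup)
  note Rsub = subgroup.subset[OF R]
  have coset_eq: "g <# ?R = h <# ?R \<longleftrightarrow> \<phi> g x = \<phi> h x" if "g \<in> carrier G" "h \<in> carrier G" for g h
  proof -
    have "g <# ?R = h <# ?R \<longleftrightarrow> inv h <# (g <# ?R) = ?R"
      using that Rsub by (metis inv_closed inv_inv lcos_m_assoc lcos_mult_one l_inv r_inv l_coset_subset_G)
    also have "inv h <# (g <# ?R) = (inv h \<otimes> g) <# ?R"
      using that Rsub by (simp add: lcos_m_assoc)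
    also have "(inv h \<otimes> g) <# ?R = ?R \<longleftrightarrow> inv h \<otimes> g \<in> ?R"
      using that R by (simp add: l_coset_self_iff)
    finally show ?thesis
      using act_eq_iff[OF x that] by simp
  qed
  \<comment> \<open>A group element carrying \<open>x\<close> to \<open>y\<close>; by
    \<open>coset_eq\<close> the coset \<open>c y <# ?R\<close> does not depend on the
    choice.\<close>
  define c where "c y = (SOME g. g \<in> carrier G \<and> \<phi> g x = y)" for y
  have c: "c y \<in> carrier G" "\<phi> (c y) x = y" if "y \<in> orbit G \<phi> x" for y
    using that someI_ex[of "\<lambda>g. g \<in> carrier G \<and> \<phi> g x = y"] by (auto simp: c_def orbit_def)
  have orb: "\<phi> g y \<in> orbit G \<phi> x" if "g \<in> carrier G" "y \<in> orbit G \<phi> x" for g y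
    using that x by (auto simp: orbit_def composition_rule[symmetric])
  let ?f = "\<lambda>y. c y <# ?R"
  have "inj_on ?f (orbit G \<phi> x)"
    by (rule inj_onI) (metis c coset_eq)
  moreover have "?f ` orbit G \<phi> x = lcosets ?R"
  proof
    show "?f ` orbit G \<phi> x \<subseteq> lcosets ?R"
      using c by (auto simp: LCOSETS_def)
    show "lcosets ?R \<subseteq> ?f ` orbit G \<phi> x"
    proof
      fix C assume "C \<in> lcosets ?R"
      then obtain g where g: "g \<in> carrier G" "C = g <# ?R"
        by (auto simp: LCOSETS_def)
      have y: "\<phi> g x \<in> orbit G \<phi> x"
        using g by (auto simp: orbit_def)
      have "?f (\<phi> g x) = C"
        using coset_eq[of "c (\<phi> g x)" g] c[OF y] g by simp
      with y show "C \<in> ?f ` orbit G \<phi> x" by blast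
    qed
  qed
  \<comment> \<open>Equivariance: \<open>c (\<phi> g y)\<close> and \<open>g \<otimes> c y\<close>
    both carry \<open>x\<close> to \<open>\<phi> g y\<close>.\<close>
  moreover have "?f (\<phi> g y) = g <# ?f y" if g: "g \<in> carrier G" and y: "y \<in> orbit G \<phi> x" for g y
  proof -
    have "\<phi> (c (\<phi> g y)) x = \<phi> (g \<otimes> c y) x"
      using c[OF orb[OF g y]] c[OF y] g x by (simp add: composition_rule)
    then have "?f (\<phi> g y) = (g \<otimes> c y) <# ?R"
      using coset_eq c[OF orb[OF g y]] c[OF y] g by simp
    also have "\<dots> = g <# ?f y"
      using c[OF y] g Rsub by (simp add: lcos_m_assoc)
    finally show ?thesis .
  qed
  ultimately show ?thesis
    unfolding gset_iso_def bij_betw_def by blast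
qed

text \<open>Equivariant bijections preserve stabilizers, and the coset \<open>R\<close> is
  stabilized exactly by \<open>R\<close>, so its preimage is the required point. Conversely,
  \<open>Y\<close> is the orbit of any of its points.\<close>

lemma gset_iso_lcosets_iff:
  assumes Y: "Y \<in> orbits G E \<phi>" and R: "subgroup R G"
  shows "gset_iso (carrier G) Y \<phi> (lcosets R) (\<lambda>g C. g <# C) \<longleftrightarrow> (\<exists>x\<in>Y. stabilizer G \<phi> x = R)"
proof
  interpret group G
    using group_hom group_hom.axioms(1) by blast
  have YE: "Y \<subseteq> E"
    using Y orbits_coverture by blast
  assume "gset_iso (carrier G) Y \<phi> (lcosets R) (\<lambda>g C. g <# C)"
  then obtain f where f: "bij_betw f Y (lcosets R)"
    and eq: "\<And>g x. g \<in> carrier G \<Longrightarrow> x \<in> Y \<Longrightarrow> f (\<phi> g x) = g <# f x"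
    unfolding gset_iso_def by blast
  have "R \<in> lcosets R"
    using lcos_mult_one[OF subgroup.subset[OF R]] by (force simp: LCOSETS_def)
  then obtain x where x: "x \<in> Y" "f x = R"
    using f by (metis bij_betw_imp_surj_on imageE)
  have "\<phi> g x = x \<longleftrightarrow> g \<in> R" if g: "g \<in> carrier G" for g
  proof -
    obtain z where z: "z \<in> E" "Y = orbit G \<phi> z"
      using Y by (auto simp: orbits_def)
    have "\<phi> g x \<in> Y"
      using z x g by (auto simp: orbit_def composition_rule[symmetric])
    then have "\<phi> g x = x \<longleftrightarrow> f (\<phi> g x) = f x"
      using x f by (metis bij_betw_imp_inj_on inj_onD)
    also have "\<dots> \<longleftrightarrow> g \<in> R"
      using eq[OF g x(1)] x l_coset_self_iff[OF R g] by simp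
    finally show ?thesis .
  qed
  then have "stabilizer G \<phi> x = R"
    using subgroup.subset[OF R] by (auto simp: stabilizer_def)
  with x show "\<exists>x\<in>Y. stabilizer G \<phi> x = R" by blast
next
  assume "\<exists>x\<in>Y. stabilizer G \<phi> x = R"
  then obtain x where x: "x \<in> Y" "stabilizer G \<phi> x = R" by blast
  then have "x \<in> E"
    using Y orbits_coverture by blast
  moreover from this have "orbit G \<phi> x \<in> orbits G E \<phi>"
    by (auto simp: orbits_def)
  then have "Y = orbit G \<phi> x"
    using disjoint_union[OF Y] x orbit_refl[OF \<open>x \<in> E\<close>] by blast
  ultimately show "gset_iso (carrier G) Y \<phi> (lcosets R) (\<lambda>g C. g <# C)"
    using orbit_gset_iso_lcosets x by blast
qed

text \<open>Since \<open>\<phi> g x\<close> has the stabilizer of \<open>x\<close> conjugated by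
  \<open>g\<close>, the points counted form the orbit of \<open>x\<close> under the normalizer of
  \<open>R\<close>. The stabilizer of \<open>x\<close> in the normalizer is still \<open>R\<close>,
  and the orbit-stabilizer theorem gives the index.\<close>

lemma card_orbit_same_stabilizer:
  assumes x: "x \<in> E" and R: "stabilizer G \<phi> x = R" and fin: "finite (carrier G)"
  shows "card {y \<in> orbit G \<phi> x. stabilizer G \<phi> y = R} = order (W G R)"
proof -
  interpret group G
    using group_hom group_hom.axioms(1) by blast
  have subR: "subgroup R G"
    using stabilizer_subgroup x R by blast
  let ?N = "normalizer G R"
  have N: "subgroup ?N G"
    by (simp add: normalizer_imp_subgroup subR subgroup.subset)
  interpret N: group_action "G\<lparr>carrier := ?N\<rparr>" E \<phi>
    by (rule induced_action[OF N])
  have "{y \<in> orbit G \<phi> x. stabilizer G \<phi> y = R} = orbit (G\<lparr>carrier := ?N\<rparr>) \<phi> x"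
    using stabilizer_act[OF x] R normalizer_eq[OF subgroup.subset[OF subR]]
    by (auto simp: orbit_def)
  moreover have "stabilizer (G\<lparr>carrier := ?N\<rparr>) \<phi> x = R"
    using R subgroup_subset_normalizer[OF subR] subgroup.subset[OF N]
    by (auto simp: stabilizer_def)
  ultimately have "card {y \<in> orbit G \<phi> x. stabilizer G \<phi> y = R} * card R = order (W G R) * card R"
    using N.orbit_stabilizer_theorem[OF x] order_W[OF subR] by (simp add: order_def)
  moreover have "card R > 0"
    using subgroup.finite_imp_card_positive[OF subR fin] .
  ultimately show ?thesis by simp
qed

text \<open>A double count: the indicator of \<open>stabilizer G \<phi> x = R\<close> is summed over
  \<open>E\<close> orbit by orbit.\<close>

lemma orbit_count_mult_order_W:
  assumes R: "subgroup R G" and fin: "finite (carrier G)" "finite E"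
  shows "orbit_count G E \<phi> R * order (W G R) = card {x \<in> E. stabilizer G \<phi> x = R}"
proof -
  let ?iso = "\<lambda>Y. gset_iso (carrier G) Y \<phi> (lcosets R) (\<lambda>g C. g <# C)"
  have finO: "finite (orbits G E \<phi>)"
    using fin(2) orbits_coverture by (metis finite_UnionD)
  have orb: "(\<Sum>x\<in>Y. if stabilizer G \<phi> x = R then 1 else 0) = (if ?iso Y then order (W G R) else 0)"
    if Y: "Y \<in> orbits G E \<phi>" for Y
  proof (cases "?iso Y")
    case True
    then obtain x where x: "x \<in> Y" "stabilizer G \<phi> x = R"
      using gset_iso_lcosets_iff[OF Y R] by blast
    then have xE: "x \<in> E"
      using Y orbits_coverture by blast
    then have "orbit G \<phi> x \<in> orbits G E \<phi>"
      by (auto simp: orbits_def)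
    then have YO: "Y = orbit G \<phi> x"
      using disjoint_union[OF Y] x orbit_refl[OF xE] by blast
    have "finite Y"
      using Y orbits_coverture fin(2) by (metis Union_upper finite_subset)
    then have "(\<Sum>x\<in>Y. if stabilizer G \<phi> x = R then 1 else 0) = card {y \<in> Y. stabilizer G \<phi> y = R}"
      using card_as_sums[OF refl] by metis
    also have "\<dots> = order (W G R)"
      using card_orbit_same_stabilizer[OF xE x(2) fin(1)] YO by simp
    finally show ?thesis using True by simp
  next
    case False
    then show ?thesis
      using gset_iso_lcosets_iff[OF Y R] by (auto intro!: sum.neutral)
  qed
  have "card {x \<in> E. stabilizer G \<phi> x = R} = (\<Sum>x\<in>E. if stabilizer G \<phi> x = R then 1 else 0)"
    using card_as_sums[OF refl fin(2)] .
  also have "\<dots> = (\<Sum>Y\<in>orbits G E \<phi>. \<Sum>x\<in>Y. if stabilizer G \<phi> x = R then 1 else 0)"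
    using disjoint_sum[OF fin(2)] by metis
  also have "\<dots> = (\<Sum>Y\<in>orbits G E \<phi>. if ?iso Y then order (W G R) else 0)"
    by (rule sum.cong[OF refl orb])
  also have "\<dots> = (\<Sum>Y\<in>{Y \<in> orbits G E \<phi>. ?iso Y}. order (W G R))"
    by (rule sum.inter_filter[OF finO, symmetric])
  also have "\<dots> = orbit_count G E \<phi> R * order (W G R)"
    by (simp add: orbit_count_def)
  finally show ?thesis by simp
qed

text \<open>A point is fixed by \<open>Q\<close> iff its stabilizer contains \<open>Q\<close>, so
  the fixed points split according to their stabilizers.\<close>

lemma card_fixed_points:
  assumes "Q \<subseteq> carrier G" "finite (carrier G)" "finite E"
  shows "card {x \<in> E. \<forall>g\<in>Q. \<phi> g x = x} =
    (\<Sum>R | subgroup R G \<and> Q \<subseteq> R. card {x \<in> E. stabilizer G \<phi> x = R})"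
proof -
  let ?I = "{R. subgroup R G \<and> Q \<subseteq> R}"
  have "?I \<subseteq> Pow (carrier G)"
    using subgroup.subset by blast
  then have finI: "finite ?I"
    using assms(2) finite_subset by blast
  have "x \<in> (\<Union>R\<in>?I. {x \<in> E. stabilizer G \<phi> x = R})" if "x \<in> E" "\<forall>g\<in>Q. \<phi> g x = x" for x
  proof -
    have "stabilizer G \<phi> x \<in> ?I"
      using that assms(1) stabilizer_subgroup[OF that(1)] by (auto simp: stabilizer_def)
    with that(1) show ?thesis by blast
  qed
  moreover have "\<forall>g\<in>Q. \<phi> g x = x" if "Q \<subseteq> stabilizer G \<phi> x" for x
    using that by (auto simp: stabilizer_def)
  ultimately have "{x \<in> E. \<forall>g\<in>Q. \<phi> g x = x} = (\<Union>R\<in>?I. {x \<in> E. stabilizer G \<phi> x = R})"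
    by blast
  then show ?thesis
    using card_UN_disjoint[OF finI, of "\<lambda>R. {x \<in> E. stabilizer G \<phi> x = R}"] assms(3) by auto
qed

end

section \<open>Conjugacy in a fusion system\<close>

lemma fus_conj_sym: "fus_conj F P Q \<Longrightarrow> fus_conj F Q P"
  unfolding fus_conj_def Iso_fus_def by blast

section \<open>Invariance of orders and of fixed-point counts under conjugacy\<close>

context fusion_system
begin

lemma finite_carrier: "finite (carrier S)"
proof -
  \<comment> \<open>An infinite carrier would have \<open>order S = 0\<close>.\<close>
  have "order S > 0"
    using p_group prime_p by (auto simp: prime_gt_0_nat)
  then show ?thesis
    by (simp add: order_gt_0_iff_finite)
qed

lemma finite_subgroups: "finite {R. subgroup R S \<and> A R}"
  by (rule finite_subset[of _ "Pow (carrier S)"]) (auto dest: subgroup.subset simp: finite_carrier)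

lemma Iso_fus_bij_betw:
  assumes "subgroup P S" "subgroup Q S" "\<phi> \<in> Iso_fus F P Q"
  shows "bij_betw \<phi> P Q"
proof -
  obtain \<psi> where \<psi>: "\<psi> \<in> F Q P" "compose P \<psi> \<phi> = (\<lambda>x\<in>P. x)" "compose Q \<phi> \<psi> = (\<lambda>x\<in>Q. x)"
    and \<phi>: "\<phi> \<in> F P Q"
    using assms(3) by (auto simp: Iso_fus_def)
  have "\<phi> \<in> P \<rightarrow> Q" "\<psi> \<in> Q \<rightarrow> P"
    using \<phi> \<psi>(1) subset_Inj_grp assms(1,2) by (fastforce simp: Inj_grp_def mon_def hom_def)+
  then show ?thesis
    using \<psi>(2,3) by (intro bij_betwI[of _ _ _ \<psi>]) (metis compose_eq restrict_apply')+
qed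

text \<open>Replacing \<open>Q\<close> by the representative of its class thus preserves the order,
  which is why the later inductions run on the order of a subgroup and not on inclusion.\<close>

lemma fus_conj_card:
  assumes "subgroup P S" "subgroup Q S" "fus_conj F P Q"
  shows "card P = card Q"
  using Iso_fus_bij_betw[OF assms(1,2)] assms(3) bij_betw_same_card unfolding fus_conj_def by blast

text \<open>Inclusion is conjugation by \<open>\<one>\<close>. It serves to enlarge the codomain of
  a morphism to \<open>carrier S\<close>, as \<open>fus_stable\<close> demands.\<close>

lemma inclusion_mem:
  assumes "subgroup P S" "subgroup Q S" "P \<subseteq> Q"
  shows "(\<lambda>x\<in>P. x) \<in> F P Q"
proof -
  have "conj_map S P \<one> = (\<lambda>x\<in>P. x)"
    using subgroup.subset[OF assms(1)] unfolding conj_map_def by (intro restrict_ext) auto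
  then have "(\<lambda>x\<in>P. x) \<in> Hom_grp S P Q"
    unfolding Hom_grp_def using assms(3)
    by (metis (mono_tags, lifting) image_restrict_eq image_ident mem_Collect_eq one_closed)
  then show ?thesis
    using Hom_grp_subset assms by blast
qed

lemma fus_conj_trans:
  assumes sub: "subgroup P S" "subgroup Q S" "subgroup R S"
    and PQ: "fus_conj F P Q" and QR: "fus_conj F Q R"
  shows "fus_conj F P R"
proof -
  obtain \<phi> \<psi> where \<phi>: "\<phi> \<in> F P Q" "\<psi> \<in> F Q P" "compose P \<psi> \<phi> = (\<lambda>x\<in>P. x)"
    "compose Q \<phi> \<psi> = (\<lambda>x\<in>Q. x)"
    using PQ by (auto simp: fus_conj_def Iso_fus_def)
  obtain \<alpha> \<beta> where \<alpha>: "\<alpha> \<in> F Q R" "\<beta> \<in> F R Q" "compose Q \<beta> \<alpha> = (\<lambda>x\<in>Q. x)"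
    "compose R \<alpha> \<beta> = (\<lambda>x\<in>R. x)"
    using QR by (auto simp: fus_conj_def Iso_fus_def)
  have m: "\<phi> x \<in> Q" if "x \<in> P" for x
    using \<phi>(1) subset_Inj_grp sub that by (fastforce simp: Inj_grp_def mon_def hom_def)
  have n: "\<beta> x \<in> Q" if "x \<in> R" for x
    using \<alpha>(2) subset_Inj_grp sub that by (fastforce simp: Inj_grp_def mon_def hom_def)
  have pw: "\<And>x. x \<in> P \<Longrightarrow> \<psi> (\<phi> x) = x" "\<And>x. x \<in> Q \<Longrightarrow> \<phi> (\<psi> x) = x"
    "\<And>x. x \<in> Q \<Longrightarrow> \<beta> (\<alpha> x) = x" "\<And>x. x \<in> R \<Longrightarrow> \<alpha> (\<beta> x) = x"
    using \<phi> \<alpha> by (metis compose_eq restrict_apply')+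
  have a: "\<alpha> x \<in> R" if "x \<in> Q" for x
    using \<alpha>(1) subset_Inj_grp sub that by (fastforce simp: Inj_grp_def mon_def hom_def)
  have b: "\<psi> x \<in> P" if "x \<in> Q" for x
    using \<phi>(2) subset_Inj_grp sub that by (fastforce simp: Inj_grp_def mon_def hom_def)
  have "compose P \<alpha> \<phi> \<in> F P R" "compose R \<psi> \<beta> \<in> F R P"
    using comp_closed sub \<phi> \<alpha> by blast+
  moreover have "compose P (compose R \<psi> \<beta>) (compose P \<alpha> \<phi>) = (\<lambda>x\<in>P. x)"
    "compose R (compose P \<alpha> \<phi>) (compose R \<psi> \<beta>) = (\<lambda>x\<in>R. x)"
    by (auto simp: compose_def restrict_def m n a b pw fun_eq_iff)
  ultimately have "compose P \<alpha> \<phi> \<in> Iso_fus F P R"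
    unfolding Iso_fus_def by blast
  then show ?thesis
    unfolding fus_conj_def by blast
qed

text \<open>Stability along an isomorphism \<phi> from \<open>P\<close> to \<open>Q\<close> gives a
  bijection \<open>f\<close> of \<open>X\<close> with \<open>f (a (\<phi> g) x) = a g (f x)\<close>.
  As \<open>g\<close> runs over \<open>P\<close>, \<open>\<phi> g\<close> runs over
  \<open>Q\<close>, so \<open>f\<close> carries the points fixed by \<open>Q\<close> onto those
  fixed by \<open>P\<close>.\<close>

lemma fus_stable_card_fixed_points:
  assumes stable: "fus_stable S F X a" and act: "group_action S X a"
    and sub: "subgroup P S" "subgroup Q S" and PQ: "fus_conj F P Q"
  shows "card {x \<in> X. \<forall>g\<in>P. a g x = x} = card {x \<in> X. \<forall>g\<in>Q. a g x = x}"
proof -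
  interpret group_action S X a by (rule act)
  obtain \<phi> where \<phi>: "\<phi> \<in> Iso_fus F P Q"
    using PQ unfolding fus_conj_def by blast
  have im: "\<phi> ` P = Q"
    using Iso_fus_bij_betw[OF sub \<phi>] by (simp add: bij_betw_def)
  note Qc = subgroup.subset[OF sub(2)] and Pc = subgroup.subset[OF sub(1)]
  have "(\<lambda>x\<in>Q. x) \<in> F Q (carrier S)"
    using inclusion_mem[OF sub(2) subgroup_self Qc] .
  then have "compose P (\<lambda>x\<in>Q. x) \<phi> \<in> F P (carrier S)"
    using comp_closed[OF sub subgroup_self] \<phi> by (auto simp: Iso_fus_def)
  then have "gset_iso P X (\<lambda>g. a (compose P (\<lambda>x\<in>Q. x) \<phi> g)) X a"
    using stable sub by (auto simp: fus_stable_def)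
  then obtain f where f: "bij_betw f X X"
    and eq: "\<And>g x. g \<in> P \<Longrightarrow> x \<in> X \<Longrightarrow> f (a (\<phi> g) x) = a g (f x)"
    using im unfolding gset_iso_def by (force simp: compose_eq)
  have aX: "a g x \<in> X" if "g \<in> carrier S" "x \<in> X" for g x
    using element_image that by blast
  have "a g (f x) = f x \<longleftrightarrow> a (\<phi> g) x = x" if "g \<in> P" "x \<in> X" for g x
    using that eq[OF that] f aX[of "\<phi> g" x] im Qc by (metis bij_betw_imp_inj_on imageI inj_onD subsetD)
  then have fixed: "(\<forall>g\<in>P. a g (f x) = f x) \<longleftrightarrow> (\<forall>g\<in>Q. a g x = x)" if "x \<in> X" for x
    using that im by blast
  have im_fix: "f ` {x \<in> X. \<forall>g\<in>Q. a g x = x} = {x \<in> X. \<forall>g\<in>P. a g x = x}"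
  proof (intro equalityI subsetI)
    fix y assume y: "y \<in> {x \<in> X. \<forall>g\<in>P. a g x = x}"
    have "y \<in> f ` X"
      unfolding bij_betw_imp_surj_on[OF f] using y by (elim CollectE conjE)
    then obtain x where x: "y = f x" "x \<in> X"
      by (rule imageE)
    have "\<forall>g\<in>P. a g (f x) = f x"
      using CollectD[OF y, THEN conjunct2] unfolding x(1) .
    with x
    show "y \<in> f ` {x \<in> X. \<forall>g\<in>Q. a g x = x}"
      using fixed by blast
  next
    fix y assume "y \<in> f ` {x \<in> X. \<forall>g\<in>Q. a g x = x}"
    then show "y \<in> {x \<in> X. \<forall>g\<in>P. a g x = x}"
      using fixed f by (auto simp: bij_betw_def)
  qed
  have "inj_on f {x \<in> X. \<forall>g\<in>Q. a g x = x}"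
    using f by (auto simp: bij_betw_def intro: inj_on_subset)
  then show ?thesis
    using card_image im_fix by fastforce
qed

end

section \<open>Signed sums over broken chains\<close>

lemma is_chain_Cons:
  assumes "\<tau> \<noteq> []"
  shows "is_chain S (Q # \<tau>) \<longleftrightarrow> subgroup Q S \<and> Q \<subset> hd \<tau> \<and> is_chain S \<tau>"
  using assms by (cases \<tau>) (auto simp: is_chain_def)

text \<open>Turns the indexed linking condition of \<open>broken_chains\<close> into a predicate
  that unfolds along list constructors.\<close>

lemma successively_iff_nth:
  "successively A xs \<longleftrightarrow> (\<forall>i. Suc i < length xs \<longrightarrow> A (xs ! i) (xs ! Suc i))"
proof (induction A xs rule: successively.induct)
  case (3 A x y xs)
  have "(\<forall>i. Suc i < length (x # y # xs) \<longrightarrow> A ((x # y # xs) ! i) ((x # y # xs) ! Suc i)) \<longleftrightarrow>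
    A x y \<and> (\<forall>i. Suc i < length (y # xs) \<longrightarrow> A ((y # xs) ! i) ((y # xs) ! Suc i))"
    by (simp add: All_less_Suc2)
  with 3 show ?case by simp
qed simp_all

text \<open>The indices from 1 on are the positions of the tail; this serves for the two conditions
  that exempt the initial chain.\<close>

lemma ball_set_tl_iff_nth:
  "(\<forall>x\<in>set (tl xs). A x) \<longleftrightarrow> (\<forall>i. 1 \<le> i \<and> i < length xs \<longrightarrow> A (xs ! i))"
proof (cases xs)
  case (Cons y ys)
  have "(\<forall>i. 1 \<le> i \<and> i < length (y # ys) \<longrightarrow> A ((y # ys) ! i)) \<longleftrightarrow>
    (\<forall>i<Suc (length ys). 1 \<le> i \<longrightarrow> A ((y # ys) ! i))"
    by auto
  also have "\<dots> \<longleftrightarrow> (\<forall>i<length ys. A (ys ! i))"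
    by (simp add: All_less_Suc2)
  finally have "(\<forall>i. 1 \<le> i \<and> i < length (y # ys) \<longrightarrow> A ((y # ys) ! i)) \<longleftrightarrow> (\<forall>i<length ys. A (ys ! i))" .
  then show ?thesis
    using Cons by (simp add: all_set_conv_all_nth)
qed simp

lemma broken_chains_iff:
  "\<sigma> \<in> broken_chains S F Ps Q P \<longleftrightarrow> \<sigma> \<noteq> [] \<and> (\<forall>\<tau>\<in>set \<sigma>. is_chain S \<tau>) \<and>
    successively (\<lambda>\<tau> \<upsilon>. fus_conj F (last \<tau>) (hd \<upsilon>)) \<sigma> \<and>
    (\<forall>\<tau>\<in>set (tl \<sigma>). hd \<tau> \<in> Ps) \<and> (\<forall>\<tau>\<in>set (tl \<sigma>). chain_length \<tau> > 0) \<and>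
    hd (hd \<sigma>) = Q \<and> fus_conj F (last (last \<sigma>)) P"
  unfolding successively_iff_nth ball_set_tl_iff_nth broken_chains_def mem_Collect_eq ..

text \<open>The tail is a broken chain from its own first subgroup, but as such its first chain
  could be trivial or start outside \<open>Ps\<close>; these two conditions are therefore listed
  separately.\<close>

lemma broken_chains_Cons_iff:
  "\<tau> # \<sigma> \<in> broken_chains S F Ps Q P \<longleftrightarrow> is_chain S \<tau> \<and> hd \<tau> = Q \<and>
    (if \<sigma> = [] then fus_conj F (last \<tau>) P
     else fus_conj F (last \<tau>) (hd (hd \<sigma>)) \<and> hd (hd \<sigma>) \<in> Ps \<and> chain_length (hd \<sigma>) > 0 \<and>
       \<sigma> \<in> broken_chains S F Ps (hd (hd \<sigma>)) P)"
  unfolding broken_chains_iff by (cases \<sigma>) auto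

definition extend_chain :: "'a set \<Rightarrow> 'a set list list \<Rightarrow> 'a set list list" where
  "extend_chain Q \<sigma> = (Q # hd \<sigma>) # tl \<sigma>"

text \<open>The sum in the theorem, with \<open>P\<close> before \<open>Q\<close> because the
  recursion varies \<open>Q\<close>. A sum over an infinite set would be 0 by default;
  \<open>finite_broken_chains\<close> excludes this case.\<close>

definition signed_count ::
  "('a, 'c) monoid_scheme \<Rightarrow> ('a set \<Rightarrow> 'a set \<Rightarrow> ('a \<Rightarrow> 'a) set) \<Rightarrow> 'a set set \<Rightarrow>
     'a set \<Rightarrow> 'a set \<Rightarrow> rat" where
  "signed_count S F Ps P Q = (\<Sum>\<sigma>\<in>broken_chains S F Ps Q P. (-1) ^ total_length \<sigma>)"

lemma broken_chains_nonempty: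
  assumes "\<sigma> \<in> broken_chains S F Ps Q P"
  obtains \<tau> \<rho> where "\<sigma> = (Q # \<tau>) # \<rho>"
proof -
  obtain \<upsilon> \<rho> where "\<sigma> = \<upsilon> # \<rho>"
    using assms by (cases \<sigma>) (auto simp: broken_chains_def)
  moreover from this have "\<upsilon> \<noteq> []" "hd \<upsilon> = Q"
    using assms by (auto simp: broken_chains_Cons_iff is_chain_def)
  ultimately show ?thesis
    using that by (metis list.collapse)
qed

lemma inj_on_extend_chain: "inj_on (extend_chain Q) (broken_chains S F Ps R P)"
  by (rule inj_onI) (auto simp: extend_chain_def elim!: broken_chains_nonempty)

text \<open>The initial chain gains one step and the number of chains is unchanged. This is the
  source of the minus sign below.\<close>

lemma total_length_extend_chain:
  assumes "\<sigma> \<in> broken_chains S F Ps R P"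
  shows "total_length (extend_chain Q \<sigma>) = Suc (total_length \<sigma>)"
  using assms
  by (auto elim!: broken_chains_nonempty simp: extend_chain_def total_length_def chain_length_def)

text \<open>Group by the second subgroup \<open>R\<close> of the initial chain. Every
  \<open>R\<close> properly above \<open>Q\<close> occurs: an initial chain need not start in
  \<open>Ps\<close>, and what is left of it may be trivial.\<close>

lemma nontrivial_broken_chains:
  assumes "subgroup Q S"
  shows "{\<sigma> \<in> broken_chains S F Ps Q P. chain_length (hd \<sigma>) > 0} =
    (\<Union>R\<in>{R. subgroup R S \<and> Q \<subset> R}. extend_chain Q ` broken_chains S F Ps R P)" (is "?A = ?B")
proof (intro equalityI subsetI)
  fix \<sigma> assume \<sigma>: "\<sigma> \<in> ?A"
  then obtain \<tau> \<rho> where \<tau>: "\<sigma> = (Q # \<tau>) # \<rho>"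
    by (auto elim: broken_chains_nonempty)
  with \<sigma> have ne: "\<tau> \<noteq> []"
    by (auto simp: chain_length_def)
  have "(Q # \<tau>) # \<rho> \<in> broken_chains S F Ps Q P"
    using \<sigma> \<tau> by simp
  then have "\<tau> # \<rho> \<in> broken_chains S F Ps (hd \<tau>) P" "Q \<subset> hd \<tau>" "is_chain S \<tau>"
    using ne unfolding broken_chains_Cons_iff[of _ \<rho>] by (auto simp: is_chain_Cons split: if_splits)
  moreover have "subgroup (hd \<tau>) S"
    using ne \<open>is_chain S \<tau>\<close> by (auto simp: is_chain_def)
  moreover have "\<sigma> = extend_chain Q (\<tau> # \<rho>)"
    by (simp add: \<tau> extend_chain_def)
  ultimately show "\<sigma> \<in> ?B" by blast
next
  fix \<sigma> assume "\<sigma> \<in> ?B"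
  then obtain R \<rho> where R: "subgroup R S" "Q \<subset> R" "\<rho> \<in> broken_chains S F Ps R P"
    "\<sigma> = extend_chain Q \<rho>" by blast
  then obtain \<tau> \<upsilon> where "\<rho> = (R # \<tau>) # \<upsilon>"
    by (auto elim: broken_chains_nonempty)
  with R show "\<sigma> \<in> ?A"
    using assms
    by (auto simp: extend_chain_def broken_chains_Cons_iff is_chain_Cons chain_length_def split: if_splits)
qed

lemma sum_nontrivial_broken_chains:
  assumes Q: "subgroup Q S" and fin: "finite (carrier S)"
    and finR: "\<And>R. subgroup R S \<Longrightarrow> Q \<subset> R \<Longrightarrow> finite (broken_chains S F Ps R P)"
  shows "(\<Sum>\<sigma> | \<sigma> \<in> broken_chains S F Ps Q P \<and> chain_length (hd \<sigma>) > 0. (-1) ^ total_length \<sigma>) =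
    - (\<Sum>R | subgroup R S \<and> Q \<subset> R. signed_count S F Ps P R)"
proof -
  let ?I = "{R. subgroup R S \<and> Q \<subset> R}"
  have finI: "finite ?I"
    by (rule finite_subset[of _ "Pow (carrier S)"]) (auto dest: subgroup.subset simp: fin)
  \<comment> \<open>The second entry of the initial chain recovers \<open>R\<close>, so the pieces
    are disjoint.\<close>
  have "extend_chain Q ` broken_chains S F Ps R P \<inter> extend_chain Q ` broken_chains S F Ps R' P = {}"
    if "R \<noteq> R'" for R R'
    using that by (auto simp: extend_chain_def elim!: broken_chains_nonempty)
  then have "(\<Sum>\<sigma> | \<sigma> \<in> broken_chains S F Ps Q P \<and> chain_length (hd \<sigma>) > 0. (-1 :: rat) ^ total_length \<sigma>) =
    (\<Sum>R\<in>?I. \<Sum>\<sigma>\<in>extend_chain Q ` broken_chains S F Ps R P. (-1) ^ total_length \<sigma>)"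
    unfolding nontrivial_broken_chains[OF Q] using finI finR by (intro sum.UNION_disjoint) auto
  also have "\<dots> = (\<Sum>R\<in>?I. - signed_count S F Ps P R)"
    by (intro sum.cong refl)
      (simp add: signed_count_def sum.reindex[OF inj_on_extend_chain] total_length_extend_chain sum_negf)
  finally show ?thesis
    by (simp add: sum_negf)
qed

section \<open>Finiteness and the recursion for the signed count\<close>

context fusion_system
begin

text \<open>With a trivial initial chain, either there is no further chain, or the next one starts
  at a member of \<open>Ps\<close> conjugate to \<open>Q\<close>. Uniqueness of representatives
  makes this \<open>R\<close>, and the rest is a broken chain from \<open>R\<close> whose first
  chain is nontrivial.\<close>

lemma trivial_broken_chains:
  assumes Q: "subgroup Q S" and reps: "fn_representatives S F Ps"
    and R: "R \<in> Ps" "fus_conj F R Q"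
  shows "{\<sigma> \<in> broken_chains S F Ps Q P. chain_length (hd \<sigma>) = 0} =
    (if fus_conj F Q P then {[[Q]]} else {}) \<union>
    (#) [Q] ` {\<sigma> \<in> broken_chains S F Ps R P. chain_length (hd \<sigma>) > 0}" (is "?A = ?B")
proof (intro equalityI subsetI)
  fix \<sigma> assume \<sigma>: "\<sigma> \<in> ?A"
  then obtain \<tau> \<rho> where \<tau>: "\<sigma> = (Q # \<tau>) # \<rho>"
    by (auto elim: broken_chains_nonempty)
  with \<sigma> have \<sigma>': "\<sigma> = [Q] # \<rho>"
    by (auto simp: chain_length_def)
  show "\<sigma> \<in> ?B"
  proof (cases "\<rho> = []")
    case True
    then show ?thesis
      using \<sigma> by (simp add: \<sigma>' broken_chains_Cons_iff)
  next
    case False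
    then have \<rho>: "fus_conj F Q (hd (hd \<rho>))" "hd (hd \<rho>) \<in> Ps" "chain_length (hd \<rho>) > 0"
      "\<rho> \<in> broken_chains S F Ps (hd (hd \<rho>)) P"
      using \<sigma> by (simp_all add: \<sigma>' broken_chains_Cons_iff)
    then have "hd (hd \<rho>) = R"
      using reps R Q fus_conj_sym unfolding fn_representatives_def by blast
    with \<rho> \<sigma>' show ?thesis by auto
  qed
next
  have chain: "is_chain S [Q]"
    using Q by (simp add: is_chain_def)
  fix \<sigma> assume "\<sigma> \<in> ?B"
  then consider "\<sigma> = [[Q]]" "fus_conj F Q P"
    | \<rho> where "\<sigma> = [Q] # \<rho>" "\<rho> \<in> broken_chains S F Ps R P" "chain_length (hd \<rho>) > 0"
    by (auto split: if_splits)
  then show "\<sigma> \<in> ?A"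
  proof cases
    case 1
    then show ?thesis
      using chain by (simp add: broken_chains_Cons_iff chain_length_def)
  next
    case 2
    then have "\<rho> \<noteq> []" "hd (hd \<rho>) = R"
      by (auto elim: broken_chains_nonempty)
    with 2 show ?thesis
      using chain R fus_conj_sym by (auto simp: broken_chains_Cons_iff chain_length_def)
  qed
qed

lemma representative:
  assumes "fn_representatives S F Ps" "subgroup Q S"
  obtains R where "R \<in> Ps" "fus_conj F R Q" "fully_normalized S F R" "subgroup R S" "card R = card Q"
proof -
  obtain R where R: "R \<in> Ps" "fus_conj F R Q" "fully_normalized S F R"
    using assms unfolding fn_representatives_def by blast
  then have "subgroup R S"
    by (simp add: fully_normalized_def)
  with R that show ?thesis
    using fus_conj_card assms by blast
qed

text \<open>The measure of the two inductions below. The bound of \<open>card R\<close> by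
  \<open>card (carrier S)\<close> keeps the truncated subtraction strict.\<close>

lemma subgroup_card_less:
  assumes "subgroup R S" "Q \<subset> R"
  shows "card (carrier S) - card R < card (carrier S) - card Q"
proof -
  have "card Q < card R" "card R \<le> card (carrier S)"
    using assms finite_carrier subgroup.subset[OF assms(1)]
    by (auto intro: psubset_card_mono card_mono finite_subset)
  then show ?thesis by simp
qed

text \<open>Induction from large subgroups to small ones: chains with trivial start reduce to
  nontrivial ones from \<open>R\<close>, and nontrivial ones reduce to larger subgroups.\<close>

lemma finite_broken_chains:
  assumes reps: "fn_representatives S F Ps" and "subgroup Q S"
  shows "finite (broken_chains S F Ps Q P)"
  using assms(2)
proof (induction "card (carrier S) - card Q" arbitrary: Q rule: less_induct)
  case less
  obtain R where R: "R \<in> Ps" "fus_conj F R Q" "subgroup R S" "card R = card Q"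
    using representative[OF reps less.prems] .
  \<comment> \<open>Stated for every \<open>Q'\<close> of the order of \<open>Q\<close>, since it is
    applied both to \<open>Q\<close> and to \<open>R\<close>.\<close>
  have nontrivial: "finite {\<sigma> \<in> broken_chains S F Ps Q' P. chain_length (hd \<sigma>) > 0}"
    if "subgroup Q' S" "card Q' = card Q" for Q'
    unfolding nontrivial_broken_chains[OF that(1)]
    using less.hyps subgroup_card_less[of _ Q'] that finite_subgroups by auto
  have "finite {\<sigma> \<in> broken_chains S F Ps Q P. chain_length (hd \<sigma>) = 0}"
    unfolding trivial_broken_chains[OF less.prems reps R(1,2)] using nontrivial[OF R(3,4)] by simp
  then have "finite ({\<sigma> \<in> broken_chains S F Ps Q P. chain_length (hd \<sigma>) > 0} \<union>
    {\<sigma> \<in> broken_chains S F Ps Q P. chain_length (hd \<sigma>) = 0})"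
    using nontrivial[OF less.prems refl] by blast
  then show ?case
    by (rule rev_finite_subset) auto
qed

text \<open>The three terms come from \<open>[[Q]]\<close>, from trivial \<sigma>_0 followed by a
  chain starting at \<open>R\<close>, and from nontrivial \<sigma>_0. In the second case two
  removals each change the sign, hence the plus.\<close>

lemma signed_count_rec:
  assumes reps: "fn_representatives S F Ps" and Q: "subgroup Q S"
    and R: "R \<in> Ps" "fus_conj F R Q" "subgroup R S"
  shows "signed_count S F Ps P Q = of_bool (fus_conj F Q P)
    + (\<Sum>T | subgroup T S \<and> R \<subset> T. signed_count S F Ps P T)
    - (\<Sum>T | subgroup T S \<and> Q \<subset> T. signed_count S F Ps P T)"
proof -
  let ?BC = "\<lambda>Q. broken_chains S F Ps Q P"
  let ?N = "\<lambda>Q. {\<sigma> \<in> ?BC Q. chain_length (hd \<sigma>) > 0}"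
  let ?Z = "{\<sigma> \<in> ?BC Q. chain_length (hd \<sigma>) = 0}"
  let ?e = "\<lambda>\<sigma>. (-1 :: rat) ^ total_length \<sigma>"
  note fin = finite_broken_chains[OF reps]
  have N: "sum ?e (?N Q') = - (\<Sum>T | subgroup T S \<and> Q' \<subset> T. signed_count S F Ps P T)"
    if "subgroup Q' S" for Q'
    by (rule sum_nontrivial_broken_chains[OF that finite_carrier fin])
  have inj: "inj_on ((#) [Q]) (?N R)"
    by simp
  \<comment> \<open>Dropping the chain \<open>[Q]\<close>, of length 0, from a list with at least
    two entries lowers the total length by exactly one.\<close>
  have "sum ?e ((#) [Q] ` ?N R) = (\<Sum>\<sigma>\<in>?N R. - ?e \<sigma>)"
    unfolding sum.reindex[OF inj]
    by (intro sum.cong refl)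
      (auto elim!: broken_chains_nonempty simp: total_length_def chain_length_def)
  moreover have "sum ?e (if fus_conj F Q P then {[[Q]]} else {}) = of_bool (fus_conj F Q P)"
    by (simp add: total_length_def chain_length_def)
  moreover have "(if fus_conj F Q P then {[[Q]]} else {}) \<inter> (#) [Q] ` ?N R = {}"
    by (auto elim: broken_chains_nonempty)
  ultimately have Z: "sum ?e ?Z = of_bool (fus_conj F Q P) - sum ?e (?N R)"
    unfolding trivial_broken_chains[OF Q reps R(1,2)]
    using fin[OF R(3)] by (subst sum.union_disjoint) (auto simp: sum_negf)
  have "signed_count S F Ps P Q = sum ?e (?N Q \<union> ?Z)"
    unfolding signed_count_def by (rule sum.cong) auto
  also have "\<dots> = sum ?e (?N Q) + sum ?e ?Z"
    using fin[OF Q] by (intro sum.union_disjoint) auto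
  finally show ?thesis
    using N[OF Q] N[OF R(3)] Z by simp
qed

section \<open>Irreducible stable sets\<close>

text \<open>Each of the two normalizers has maximal order within the class, so their orders agree,
  as do those of the subgroups.\<close>

lemma fully_normalized_order_W:
  assumes "fully_normalized S F P" "fully_normalized S F Q" "fus_conj F P Q"
  shows "order (W S P) = order (W S Q)"
proof -
  have sub: "subgroup P S" "subgroup Q S"
    using assms by (auto simp: fully_normalized_def)
  have "card (normalizer S P) = card (normalizer S Q)"
    using assms sub fus_conj_sym unfolding fully_normalized_def by (meson le_antisym)
  then have "order (W S P) * card P = order (W S Q) * card P"
    using order_W sub fus_conj_card[OF sub assms(3)] by metis
  moreover have "card P > 0"
    using subgroup.finite_imp_card_positive[OF sub(1) finite_carrier] .
  ultimately show ?thesis by simp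
qed

text \<open>Counting points instead of orbits removes the weights that depend on \<open>Q\<close>:
  fixed-point numbers are then plain sums over larger subgroups, as in
  \<open>signed_count_rec\<close>.\<close>

lemma point_count_eq_signed_count:
  assumes reps: "fn_representatives S F Ps" and P: "subgroup P S"
    and Pst: "fully_normalized S F Pst" "fus_conj F Pst P"
    and alpha: "is_alpha S F P X a" and "subgroup Q S"
  shows "of_nat (card {x \<in> X. stabilizer S a x = Q}) = of_nat (order (W S Pst)) * signed_count S F Ps P Q"
  using \<open>subgroup Q S\<close>
proof (induction "card (carrier S) - card Q" arbitrary: Q rule: less_induct)
  case less
  let ?w = "of_nat (order (W S Pst)) :: rat"
  let ?u = "\<lambda>Q. card {x \<in> X. stabilizer S a x = Q}"
  let ?above = "\<lambda>Q. {T. subgroup T S \<and> Q \<subset> T}"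
  interpret group_action S X a
    using alpha by (simp add: is_alpha_def)
  have fX: "finite X"
    using alpha by (simp add: is_alpha_def)
  obtain R where R: "R \<in> Ps" "fus_conj F R Q" "fully_normalized S F R" "subgroup R S"
    "card R = card Q"
    using representative[OF reps less.prems] .
  have RP: "fus_conj F R P \<longleftrightarrow> fus_conj F Q P"
    using fus_conj_trans fus_conj_sym R(2,4) less.prems P by blast
  \<comment> \<open>The defining conditions of \<alpha>_P speak of fully normalized subgroups, so
    they are read off at \<open>R\<close>; \<open>Pst\<close> and \<open>R\<close> have equal
    \<open>W\<close>-orders when conjugate.\<close>
  have uR: "rat_of_nat (?u R) = ?w * of_bool (fus_conj F Q P)"
  proof (cases "fus_conj F Q P")
    case True
    then have "orbit_count S X a R = 1"
      using alpha R(3) RP by (simp add: is_alpha_def)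
    moreover have "order (W S R) = order (W S Pst)"
      using fully_normalized_order_W[OF R(3) Pst(1)] fus_conj_trans[OF R(4) P _ _ fus_conj_sym[OF Pst(2)]]
        True RP Pst(1) by (simp add: fully_normalized_def)
    ultimately show ?thesis
      using orbit_count_mult_order_W[OF R(4) finite_carrier fX] True by simp
  next
    case False
    then have "orbit_count S X a R = 0"
      using alpha R(3) RP by (simp add: is_alpha_def)
    then show ?thesis
      using orbit_count_mult_order_W[OF R(4) finite_carrier fX] False by simp
  qed
  have fixed: "card {x \<in> X. \<forall>g\<in>Q'. a g x = x} = ?u Q' + sum ?u (?above Q')" if "subgroup Q' S" for Q'
  proof -
    have "{T. subgroup T S \<and> Q' \<subseteq> T} = insert Q' (?above Q')"
      using that by auto
    then show ?thesis
      using card_fixed_points[OF subgroup.subset[OF that] finite_carrier fX] finite_subgroups by simp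
  qed
  have "?u Q + sum ?u (?above Q) = ?u R + sum ?u (?above R)"
    using fus_stable_card_fixed_points[OF _ group_action_axioms R(4) less.prems R(2)] alpha
      fixed[OF R(4)] fixed[OF less.prems] by (simp add: is_alpha_def)
  then have "rat_of_nat (?u Q + sum ?u (?above Q)) = of_nat (?u R + sum ?u (?above R))"
    by (rule arg_cong)
  then have stable: "rat_of_nat (?u Q) + (\<Sum>T\<in>?above Q. of_nat (?u T)) = of_nat (?u R) + (\<Sum>T\<in>?above R. of_nat (?u T))"
    unfolding of_nat_add of_nat_sum .
  \<comment> \<open>The induction hypothesis applies above \<open>R\<close> as well as above
    \<open>Q\<close>, because both have the same order.\<close>
  have above: "(\<Sum>T\<in>?above Q'. rat_of_nat (?u T)) = ?w * (\<Sum>T\<in>?above Q'. signed_count S F Ps P T)"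
    if "card Q' = card Q" for Q'
    unfolding sum_distrib_left
    using less.hyps subgroup_card_less[of _ Q'] that by (intro sum.cong refl) auto
  have "rat_of_nat (?u Q) = ?w * (of_bool (fus_conj F Q P)
      + (\<Sum>T\<in>?above R. signed_count S F Ps P T) - (\<Sum>T\<in>?above Q. signed_count S F Ps P T))"
    using stable uR unfolding above[OF refl] above[OF R(5)] by (simp add: algebra_simps)
  then show ?case
    using signed_count_rec[OF reps less.prems R(1,2,4)] by simp
qed

end

theorem theorem1p2:
  fixes S :: "('a, 'c) monoid_scheme" and p :: nat
    and F :: "'a set \<Rightarrow> 'a set \<Rightarrow> ('a \<Rightarrow> 'a) set"
    and Ps :: "'a set set" and P Pst Q :: "'a set"
    and X :: "'x set" and a :: "'a \<Rightarrow> 'x \<Rightarrow> 'x"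
  assumes "saturated_fusion_system S p F"
    and "fn_representatives S F Ps"
    and "subgroup P S" and "subgroup Q S"
    and "fully_normalized S F Pst" and "fus_conj F Pst P"
    and "is_alpha S F P X a"
  shows "(of_nat (orbit_count S X a Q) :: rat) =
    of_nat (order (W S Pst)) / of_nat (order (W S Q)) *
      (\<Sum>\<sigma>\<in>broken_chains S F Ps Q P. (-1) ^ total_length \<sigma>)"
proof -
  interpret saturated_fusion_system S p F by (rule assms(1))
  interpret group_action S X a
    using assms(7) by (simp add: is_alpha_def)
  have "finite X"
    using assms(7) by (simp add: is_alpha_def)
  then have "rat_of_nat (orbit_count S X a Q) * of_nat (order (W S Q)) =
    of_nat (order (W S Pst)) * signed_count S F Ps P Q"
    using point_count_eq_signed_count[OF assms(2,3,5,6,7,4)]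
      orbit_count_mult_order_W[OF assms(4) finite_carrier] by (metis of_nat_mult)
  \<comment> \<open>Needed to divide; it holds because \<open>order (W S Q) * card Q\<close> is the
    positive order of the normalizer.\<close>
  moreover have "order (W S Q) \<noteq> 0"
  proof -
    have "card (normalizer S Q) > 0"
      using subgroup.finite_imp_card_positive[OF normalizer_imp_subgroup finite_carrier]
        subgroup.subset[OF assms(4)] by blast
    then show ?thesis
      using order_W[OF assms(4)] by (metis mult_0 less_irrefl)
  qed
  ultimately show ?thesis
    by (simp add: signed_count_def field_simps)
qed

end
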